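(* Let $L:\mathbb{R}^d\to\mathbb{R}$ be twice continuously differentiable and strictly convex with minimizer $\theta^*$, put $\mu=\lambda_{\min}(\nabla^2 L(\theta^* ))$ and $\min L=L(\theta^* )$, and suppose there is a constant $R>0$ such that for all $\theta,\theta'\in\mathbb{R}^d$, $\|\theta-\theta'\|_2\le R$ implies $\|\nabla^2 L(\theta')^{-1}\nabla^2 L(\theta)\|_2\le 2$ (in particular $\nabla^2 L$ is invertible everywhere). Let $\eta=\tfrac12$ and $\rho=\frac{R}{2\sqrt d}$, let $\theta_0\in\mathbb{R}^d$ be the initialization, and let $(\theta_t)_{t\ge 0}$ be defined by $$\theta_{t+1}=\theta_t-\eta\, V_t^\top \mathrm{clip}\big(V_t(\nabla^2 L(\theta_t))^{-1}\nabla L(\theta_t),\rho\big),$$ where $\nabla^2 L(\theta_t)=V_t^\top\Sigma_tV_t$ is an eigendecomposition of $\nabla^2 L(\theta_t)$. Then the update reaches a loss at most $\epsilon$ (that is, $L(\theta_T)-\min L\le\epsilon$) in $$T\lesssim d\cdot\frac{L(\theta_0)-\min L}{\mu R^2}+\ln\frac{\mu R^2}{32 d\,\epsilon}$$ steps.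
   Context: For a matrix, $\|\cdot\|_2$ is the spectral (operator) norm; for a vector it is the Euclidean norm. $\lambda_{\min}$ denotes the smallest eigenvalue. For $z\in\mathbb{R}^d$ and $\rho>0$, $\mathrm{clip}(z,\rho)=\max\{\min\{z,\rho\},-\rho\}$ applied coordinate-wise. In an eigendecomposition $\nabla^2L(\theta_t)=V_t^\top\Sigma_tV_t$, the matrix $V_t$ is orthogonal and $\Sigma_t$ is diagonal. Here $\epsilon>0$ is the target accuracy, and $\lesssim$ means inequality up to a universal multiplicative constant.
   Formalization: The logarithm in the bound is replaced by its positive part max(0, ln(μR²/(32dε))), because for ε > μR²/(32d) the stated bound can be negative and the claim then fails (e.g. d=1, L=x²/2, R²=32, ε=2, L(θ₀)=2.1). *)

theory Defs
  imports "HOL-Analysis.Analysis"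
begin

text \<open>Meaningful only at points where \<open>f\<close> is differentiable.\<close>

definition gradient :: "(real^'n \<Rightarrow> real) \<Rightarrow> real^'n \<Rightarrow> real^'n" where
  "gradient f x = (THE D. GDERIV f x :> D)"

definition hessian :: "(real^'n \<Rightarrow> real) \<Rightarrow> real^'n \<Rightarrow> real^'n^'n" where
  "hessian f x = jacobian (gradient f) (at x)"

definition twice_continuously_differentiable :: "(real^'n \<Rightarrow> real) \<Rightarrow> bool" where
  "twice_continuously_differentiable f \<longleftrightarrow>
     (\<forall>x. f differentiable (at x)) \<and>
     (\<forall>x. gradient f differentiable (at x)) \<and>
     continuous_on UNIV (hessian f)"

definition strictly_convex :: "('a::real_vector \<Rightarrow> real) \<Rightarrow> bool" where
  "strictly_convex f \<longleftrightarrow>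
     (\<forall>x y u. x \<noteq> y \<longrightarrow> 0 < u \<longrightarrow> u < 1 \<longrightarrow>
        f ((1 - u) *\<^sub>R x + u *\<^sub>R y) < (1 - u) * f x + u * f y)"

definition eigenvalue :: "real^'n^'n \<Rightarrow> real \<Rightarrow> bool" where
  "eigenvalue A l \<longleftrightarrow> (\<exists>v. v \<noteq> 0 \<and> A *v v = l *\<^sub>R v)"

text \<open>Unspecified if \<open>A\<close> has no real eigenvalue; used only for (symmetric) Hessians.\<close>

definition lambda_min :: "real^'n^'n \<Rightarrow> real" where
  "lambda_min A = (LEAST l. eigenvalue A l)"

definition spectral_norm :: "real^'n^'m \<Rightarrow> real" where
  "spectral_norm A = onorm ((*v) A)"

definition clip :: "real^'n \<Rightarrow> real \<Rightarrow> real^'n" where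
  "clip z \<rho> = (\<chi> i. max (min (z $ i) \<rho>) (- \<rho>))"

definition diagonal :: "real^'n^'n \<Rightarrow> bool" where
  "diagonal A \<longleftrightarrow> (\<forall>i j. i \<noteq> j \<longrightarrow> A $ i $ j = 0)"

text \<open>The convention is \<open>A = V\<^sup>T S V\<close>: the eigenvectors are the rows of \<open>V\<close>.\<close>

definition eigendecomposition ::
  "real^'n^'n \<Rightarrow> real^'n^'n \<Rightarrow> real^'n^'n \<Rightarrow> bool" where
  "eigendecomposition A V S \<longleftrightarrow>
     orthogonal_matrix V \<and> diagonal S \<and> A = transpose V ** S ** V"

end

theory Submission
  imports Defs
begin

text \<open>
  Write \<open>H\<close> for the Hessian. The hypothesis on \<open>H(x')\<^sup>-\<^sup>1 H(x)\<close> says that \<open>v \<bullet> H(x) v \<le> 2 (v \<bullet> H(x') v)\<close> for points at distance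
  at most \<open>R\<close>. Let \<open>W\<close> be the inner product of the gradient with the clipped Newton step.
  By Taylor's formula a step of half that length decreases the loss by at least \<open>W / 4\<close>.
  Conversely \<open>W \<ge> min (\<mu> \<rho>\<^sup>2 / 4) ((L(x) - min L) / 2)\<close>. To see this, put \<open>w = x - \<theta>\<^sup>*\<close> and bound
  \<open>G = \<nabla>L(x) \<bullet> w \<ge> L(x) - min L\<close> coordinatewise in the eigenbasis of \<open>H(x)\<close>: unclipped coordinates by
  AM-GM against \<open>w \<bullet> H(x) w\<close>, which is itself controlled by \<open>G\<close> along the segment to \<open>\<theta>\<^sup>*\<close>; clipped
  ones by \<open>W |w| / \<rho>\<close>. If \<open>|w| > R\<close>, the curvature near \<open>\<theta>\<^sup>*\<close> gives \<open>G \<ge> \<mu> R |w| / 2\<close>; if \<open>|w| \<le> R\<close>, either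
  nothing is clipped or a clipped coordinate with eigenvalue at least \<open>\<mu> / 2\<close> alone makes \<open>W\<close> large.
  The resulting recursion for the excess loss has a linear phase followed by a geometric one.
\<close>

subsection \<open>Gradients, Hessians and convexity\<close>

text \<open>Justifies the definite description in \<open>gradient\<close>: existence is Riesz
  representation, with the adjoint evaluated at 1 as representative, and uniqueness is that of the
  derivative.\<close>

lemma GDERIV_gradient:
  assumes "f differentiable (at x)"
  shows "GDERIV f x :> gradient f x"
proof -
  obtain f' where f': "(f has_derivative f') (at x)"
    using assms by (auto simp: differentiable_def)
  then have lin: "linear f'" by (rule has_derivative_linear)
  have "f' = (\<lambda>h. h \<bullet> adjoint f' 1)"
    using adjoint_works[OF lin, of _ 1] by (auto simp: inner_commute)
  then have ex: "GDERIV f x :> adjoint f' 1"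
    using f' by (simp add: gderiv_def)
  have "D = E" if "GDERIV f x :> D" "GDERIV f x :> E" for D E
  proof -
    have "(\<lambda>h. h \<bullet> D) = (\<lambda>h. h \<bullet> E)"
      using that has_derivative_unique unfolding gderiv_def by blast
    then show ?thesis by (metis vector_eq_ldot)
  qed
  with ex have "\<exists>!D. GDERIV f x :> D" by blast
  then show ?thesis unfolding gradient_def by (rule theI')
qed

lemma has_derivative_gradient:
  assumes "gradient f differentiable (at x)"
  shows "(gradient f has_derivative (*v) (hessian f x)) (at x)"
  using assms jacobian_works[of "gradient f" "at x"] by (simp add: hessian_def)

lemma DERIV_along_line:
  assumes "\<And>x. f differentiable (at x)"
  shows "((\<lambda>s. f (x + s *\<^sub>R w)) has_real_derivative gradient f (x + s *\<^sub>R w) \<bullet> w) (at s)"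
proof -
  have "(f has_derivative (\<lambda>h. h \<bullet> gradient f (x + s *\<^sub>R w))) (at (x + s *\<^sub>R w))"
    using GDERIV_gradient[OF assms] by (simp add: gderiv_def)
  moreover have "((\<lambda>s. x + s *\<^sub>R w) has_derivative (\<lambda>h. h *\<^sub>R w)) (at s)"
    by (auto intro!: derivative_eq_intros)
  ultimately have "((\<lambda>s. f (x + s *\<^sub>R w)) has_derivative (\<lambda>h. (h *\<^sub>R w) \<bullet> gradient f (x + s *\<^sub>R w))) (at s)"
    by (rule has_derivative_compose[rotated])
  then show ?thesis
    by (simp add: has_field_derivative_def inner_commute mult_commute_abs)
qed

lemma DERIV_gradient_along_line:
  assumes "\<And>x. gradient f differentiable (at x)"
  shows "((\<lambda>s. gradient f (x + s *\<^sub>R w) \<bullet> v) has_real_derivative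
           (hessian f (x + s *\<^sub>R w) *v w) \<bullet> v) (at s)"
proof -
  have "((\<lambda>s. x + s *\<^sub>R w) has_derivative (\<lambda>h. h *\<^sub>R w)) (at s)"
    by (auto intro!: derivative_eq_intros)
  then have "((\<lambda>s. gradient f (x + s *\<^sub>R w)) has_derivative
      (\<lambda>h. hessian f (x + s *\<^sub>R w) *v (h *\<^sub>R w))) (at s)"
    using has_derivative_gradient[OF assms] by (rule has_derivative_compose)
  then have "((\<lambda>s. gradient f (x + s *\<^sub>R w) \<bullet> v) has_derivative
      (\<lambda>h. (hessian f (x + s *\<^sub>R w) *v (h *\<^sub>R w)) \<bullet> v)) (at s)"
    by (rule has_derivative_inner_left)
  then show ?thesis
    by (simp add: has_field_derivative_def mult_commute_abs matrix_vector_mult_scaleR)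
qed

text \<open>The mean value theorem in direction \<open>u\<close> turns the second difference into a
  difference of gradients at two points within O(t) of \<open>x\<close>. Expanding both to first
  order at \<open>x\<close> leaves the Hessian form times t^2, up to an error o(t^2).\<close>

lemma second_difference_tendsto_hessian:
  assumes f: "\<And>x. f differentiable (at x)" and g: "gradient f differentiable (at x)"
  shows "((\<lambda>t. (f (x + t *\<^sub>R u + t *\<^sub>R v) - f (x + t *\<^sub>R u) - f (x + t *\<^sub>R v) + f x) / t\<^sup>2)
           \<longlongrightarrow> u \<bullet> (hessian f x *v v)) (at_right 0)"
proof (rule tendstoI)
  fix e :: real assume "e > 0"
  define H where "H = hessian f x"
  \<comment> \<open>The final error is at most \<open>c * (M - 1)\<close>, which is below
    \<open>e\<close> by the choice of \<open>c\<close>. The summand 1 keeps \<open>M\<close>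
    positive when \<open>u = 0\<close>.\<close>
  define M where "M = 2 * (norm u + norm v) * norm u + 1"
  have "M > 0" unfolding M_def by (auto intro!: add_nonneg_pos mult_nonneg_nonneg)
  define c where "c = e / (2 * M)"
  have "c > 0" using \<open>e > 0\<close> \<open>M > 0\<close> by (simp add: c_def)
  obtain d where "d > 0" and d: "\<And>h. norm h < d \<Longrightarrow>
      norm (gradient f (x + h) - gradient f x - H *v h) \<le> c * norm h"
  proof -
    have "(gradient f has_derivative (*v) H) (at x)"
      unfolding H_def by (rule has_derivative_gradient[OF g])
    then obtain d where "d > 0" and d: "\<And>y. norm (y - x) < d \<Longrightarrow>
        norm (gradient f y - gradient f x - H *v (y - x)) \<le> c * norm (y - x)"
      using \<open>c > 0\<close> unfolding has_derivative_at_alt by meson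
    show thesis
      using that[OF \<open>d > 0\<close>] d[of "x + _"] by simp
  qed
  \<comment> \<open>For \<open>t < d / N\<close> both displacements \<open>h1\<close> and
    \<open>h2\<close> below stay inside the ball of radius \<open>d\<close>.\<close>
  define N where "N = norm u + norm v + 1"
  have "N > 0" by (simp add: N_def add_nonneg_pos)
  have "eventually (\<lambda>t. t \<in> {0<..<d / N}) (at_right 0)"
    by (rule eventually_at_right_real) (use \<open>d > 0\<close> \<open>N > 0\<close> in simp)
  then show "\<forall>\<^sub>F t in at_right 0. dist ((f (x + t *\<^sub>R u + t *\<^sub>R v) - f (x + t *\<^sub>R u) - f (x + t *\<^sub>R v) + f x) / t\<^sup>2) (u \<bullet> (hessian f x *v v)) < e"
  proof eventually_elim
    case (elim t)
    then have "t > 0" and tN: "t * N < d" using \<open>N > 0\<close> by (auto simp: field_simps)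
    have D1: "((\<lambda>s. f (x + t *\<^sub>R v + s *\<^sub>R (t *\<^sub>R u)) - f (x + s *\<^sub>R (t *\<^sub>R u))) has_real_derivative
        gradient f (x + t *\<^sub>R v + s *\<^sub>R (t *\<^sub>R u)) \<bullet> (t *\<^sub>R u) - gradient f (x + s *\<^sub>R (t *\<^sub>R u)) \<bullet> (t *\<^sub>R u)) (at s)" for s
      by (intro DERIV_diff DERIV_along_line f)
    obtain s where s: "0 < s" "s < 1" and eq:
      "(f (x + t *\<^sub>R v + 1 *\<^sub>R (t *\<^sub>R u)) - f (x + 1 *\<^sub>R (t *\<^sub>R u))) - (f (x + t *\<^sub>R v + 0 *\<^sub>R (t *\<^sub>R u)) - f (x + 0 *\<^sub>R (t *\<^sub>R u)))
       = (1 - 0) * (gradient f (x + t *\<^sub>R v + s *\<^sub>R (t *\<^sub>R u)) \<bullet> (t *\<^sub>R u) - gradient f (x + s *\<^sub>R (t *\<^sub>R u)) \<bullet> (t *\<^sub>R u))"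
      using MVT2[of 0 1, OF _ D1] by auto
    define h1 where "h1 = t *\<^sub>R v + s *\<^sub>R (t *\<^sub>R u)"
    define h2 where "h2 = s *\<^sub>R (t *\<^sub>R u)"
    define r where "r h = gradient f (x + h) - gradient f x - H *v h" for h
    have n: "norm h1 \<le> t * (norm u + norm v)" "norm h2 \<le> t * (norm u + norm v)"
    proof -
      have "norm h2 = s * (t * norm u)" using s \<open>t > 0\<close> by (simp add: h2_def)
      also have "\<dots> \<le> 1 * (t * norm u)" using s \<open>t > 0\<close> by (intro mult_right_mono) auto
      finally have h2: "norm h2 \<le> t * norm u" by simp
      then show "norm h2 \<le> t * (norm u + norm v)" using \<open>t > 0\<close>
        by (smt (verit) distrib_left mult_nonneg_nonneg norm_ge_zero)
      have "norm h1 \<le> t * norm v + norm h2"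
        unfolding h1_def using \<open>t > 0\<close> norm_triangle_ineq[of "t *\<^sub>R v" h2] by (simp add: h2_def)
      then show "norm h1 \<le> t * (norm u + norm v)" using h2 by (simp add: distrib_left)
    qed
    have "t * (norm u + norm v) < d"
      using tN \<open>t > 0\<close> by (simp add: N_def distrib_left)
    with n have r: "norm (r h1) \<le> c * (t * (norm u + norm v))" "norm (r h2) \<le> c * (t * (norm u + norm v))"
      unfolding r_def using \<open>c > 0\<close>
      by (meson d less_imp_le mult_left_mono order.trans order.strict_trans1)+
    have "f (x + t *\<^sub>R u + t *\<^sub>R v) - f (x + t *\<^sub>R u) - f (x + t *\<^sub>R v) + f x
        = (gradient f (x + h1) - gradient f (x + h2)) \<bullet> (t *\<^sub>R u)"
      using eq by (simp add: h1_def h2_def algebra_simps)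
    also have "gradient f (x + h1) - gradient f (x + h2) = t *\<^sub>R (H *v v) + (r h1 - r h2)"
      by (simp add: r_def h1_def h2_def matrix_vector_right_distrib matrix_vector_mult_scaleR)
    finally have "f (x + t *\<^sub>R u + t *\<^sub>R v) - f (x + t *\<^sub>R u) - f (x + t *\<^sub>R v) + f x
        = t\<^sup>2 * (u \<bullet> (H *v v)) + t * ((r h1 - r h2) \<bullet> u)"
      by (simp add: inner_add_left inner_commute power2_eq_square algebra_simps)
    then have "(f (x + t *\<^sub>R u + t *\<^sub>R v) - f (x + t *\<^sub>R u) - f (x + t *\<^sub>R v) + f x) / t\<^sup>2 - u \<bullet> (H *v v)
        = ((r h1 - r h2) \<bullet> u) / t"
      using \<open>t > 0\<close> by (simp add: field_simps power2_eq_square)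
    moreover have "\<bar>((r h1 - r h2) \<bullet> u) / t\<bar> < e"
    proof -
      have "\<bar>(r h1 - r h2) \<bullet> u\<bar> \<le> norm (r h1 - r h2) * norm u"
        by (rule Cauchy_Schwarz_ineq2)
      also have "\<dots> \<le> (2 * (c * (t * (norm u + norm v)))) * norm u"
        using norm_triangle_ineq4[of "r h1" "r h2"] r by (intro mult_right_mono) auto
      also have "\<dots> = c * t * (M - 1)" by (simp add: M_def algebra_simps)
      also have "\<dots> < c * t * (2 * M)" using \<open>c > 0\<close> \<open>t > 0\<close> \<open>M > 0\<close> by (intro mult_strict_left_mono) auto
      also have "\<dots> = e * t" using \<open>M > 0\<close> by (simp add: c_def)
      finally show ?thesis using \<open>t > 0\<close> by (simp add: field_simps)
    qed
    ultimately show ?case by (simp add: dist_real_def H_def)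
  qed
qed

text \<open>The second difference is unchanged when \<open>u\<close> and \<open>v\<close> are
  swapped, so its two limits agree.\<close>

lemma hessian_symmetric:
  assumes f: "\<And>x. f differentiable (at x)" and g: "gradient f differentiable (at x)"
  shows "u \<bullet> (hessian f x *v v) = v \<bullet> (hessian f x *v u)"
proof -
  have *: "x + t *\<^sub>R v + t *\<^sub>R u = x + t *\<^sub>R u + t *\<^sub>R v" for t by (simp add: add_ac)
  have "((\<lambda>t. (f (x + t *\<^sub>R u + t *\<^sub>R v) - f (x + t *\<^sub>R u) - f (x + t *\<^sub>R v) + f x) / t\<^sup>2)
           \<longlongrightarrow> v \<bullet> (hessian f x *v u)) (at_right 0)"
    using second_difference_tendsto_hessian[OF f g, of v u] by (simp add: * algebra_simps)
  then show ?thesis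
    using second_difference_tendsto_hessian[OF f g, of u v] tendsto_unique trivial_limit_at_right_real by blast
qed

section \<open>Tangents, positive semidefinite Hessians and Taylor's formula\<close>

lemma strictly_convex_imp_convex_on_line:
  assumes "strictly_convex f"
  shows "convex_on UNIV (\<lambda>s. f (x + s *\<^sub>R w))"
proof (rule convex_onI)
  fix t a b :: real assume t: "0 < t" "t < 1"
  show "f (x + ((1 - t) *\<^sub>R a + t *\<^sub>R b) *\<^sub>R w) \<le> (1 - t) * f (x + a *\<^sub>R w) + t * f (x + b *\<^sub>R w)"
  \<comment> \<open>Strict convexity speaks only of distinct points; here they coincide when
    \<open>a = b\<close> or \<open>w = 0\<close>.\<close>
  proof (cases "x + a *\<^sub>R w = x + b *\<^sub>R w")
    case True
    then have eq: "a *\<^sub>R w = b *\<^sub>R w" by (rule add_left_imp_eq)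
    have "((1 - t) *\<^sub>R a + t *\<^sub>R b) *\<^sub>R w = (1 - t) *\<^sub>R (a *\<^sub>R w) + t *\<^sub>R (b *\<^sub>R w)"
      by (simp add: scaleR_add_left)
    also have "\<dots> = ((1 - t) + t) *\<^sub>R (b *\<^sub>R w)"
      unfolding eq by (rule scaleR_add_left[symmetric])
    finally have "x + ((1 - t) *\<^sub>R a + t *\<^sub>R b) *\<^sub>R w = x + b *\<^sub>R w" by simp
    then show ?thesis unfolding True by (simp only:) (simp add: algebra_simps)
  next
    case False
    have "x + ((1 - t) *\<^sub>R a + t *\<^sub>R b) *\<^sub>R w = (1 - t) *\<^sub>R (x + a *\<^sub>R w) + t *\<^sub>R (x + b *\<^sub>R w)"
      by (simp add: algebra_simps)
    then show ?thesis using assms False t unfolding strictly_convex_def by (metis less_imp_le)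
  qed
qed auto

lemma strictly_convex_above_tangent:
  assumes f: "\<And>x. f differentiable (at x)" and "strictly_convex f"
  shows "f x + gradient f x \<bullet> w \<le> f (x + w)"
proof -
  have "f (x + 1 *\<^sub>R w) - f (x + 0 *\<^sub>R w) \<ge> gradient f (x + 0 *\<^sub>R w) \<bullet> w * (1 - 0)"
    by (rule convex_on_imp_above_tangent[OF strictly_convex_imp_convex_on_line[OF assms(2)]])
      (use DERIV_along_line[of f x w 0, OF f] in \<open>auto simp: has_field_derivative_at_within\<close>)
  then show ?thesis by simp
qed

text \<open>Adding the tangent inequalities at \<open>x\<close> and \<open>x + s *\<^sub>R v\<close>
  shows that the slope along \<open>v\<close> is nowhere smaller for \<open>s > 0\<close> than at 0,
  so its derivative at 0, the quadratic form, cannot be negative.\<close>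

lemma hessian_nonneg:
  assumes f: "\<And>x. f differentiable (at x)" and g: "\<And>x. gradient f differentiable (at x)"
    and "strictly_convex f"
  shows "0 \<le> v \<bullet> (hessian f x *v v)"
proof -
  have "(gradient f (x + s *\<^sub>R v) - gradient f x) \<bullet> (s *\<^sub>R v) \<ge> 0" for s
    using strictly_convex_above_tangent[OF f assms(3), of x "s *\<^sub>R v"]
      strictly_convex_above_tangent[OF f assms(3), of "x + s *\<^sub>R v" "- (s *\<^sub>R v)"]
    by (simp add: algebra_simps)
  then have mono: "gradient f x \<bullet> v \<le> gradient f (x + s *\<^sub>R v) \<bullet> v" if "s > 0" for s
    using that by (metis diff_ge_0_iff_ge inner_diff_left inner_scaleR_right zero_le_mult_iff not_less)
  have "0 \<le> (hessian f (x + 0 *\<^sub>R v) *v v) \<bullet> v"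
  proof (rule ccontr)
    assume "\<not> ?thesis"
    then obtain d where "d > 0" "\<forall>h>0. h < d \<longrightarrow> gradient f (x + (0 + h) *\<^sub>R v) \<bullet> v < gradient f (x + 0 *\<^sub>R v) \<bullet> v"
      using DERIV_neg_dec_right[OF DERIV_gradient_along_line[OF g, of x v v 0]] by (auto simp: not_le)
    then show False using mono[of "d / 2"] by (auto dest: spec[of _ "d/2"])
  qed
  then show ?thesis by (simp add: inner_commute)
qed

lemma second_order_Taylor_upper:
  assumes f: "\<And>x. f differentiable (at x)" and g: "\<And>x. gradient f differentiable (at x)"
    and K: "\<And>s. 0 \<le> s \<Longrightarrow> s \<le> 1 \<Longrightarrow> (hessian f (x + s *\<^sub>R w) *v w) \<bullet> w \<le> K"
  shows "f (x + w) \<le> f x + gradient f x \<bullet> w + K / 2"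
proof -
  define D where "D m s = (if m = 0 then f (x + s *\<^sub>R w)
    else if m = 1 then gradient f (x + s *\<^sub>R w) \<bullet> w
    else (hessian f (x + s *\<^sub>R w) *v w) \<bullet> w)" for m :: nat and s
  have "\<forall>m t. m < 2 \<and> 0 \<le> t \<and> t \<le> 1 \<longrightarrow> (D m has_real_derivative D (Suc m) t) (at t)"
    by (auto simp: D_def [abs_def] less_2_cases_iff intro: DERIV_along_line[OF f] DERIV_gradient_along_line[OF g])
  from Taylor_up[of 2 D "D 0" 0 1 0, OF _ _ this] obtain t where t: "0 < t" "t < 1"
    "D 0 1 = (\<Sum>m<2. D m 0 / fact m * (1 - 0) ^ m) + D 2 t / fact 2 * (1 - 0)\<^sup>2" by auto
  then have "f (x + w) = f x + gradient f x \<bullet> w + (hessian f (x + t *\<^sub>R w) *v w) \<bullet> w / 2"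
    by (simp add: D_def numeral_2_eq_2)
  with K[of t] t show ?thesis by simp
qed

subsection \<open>Positive definite forms\<close>

lemma matrix_inv_mult:
  fixes A :: "real^'n^'n"
  assumes "invertible A"
  shows "A ** matrix_inv A = mat 1" "matrix_inv A ** A = mat 1"
  using someI_ex[OF assms[unfolded invertible_def]] by (auto simp: matrix_inv_def)

lemma continuous_on_quadratic_form:
  fixes A :: "real^'n^'n"
  shows "continuous_on X (\<lambda>v. v \<bullet> (A *v v))"
  by (intro continuous_intros linear_continuous_on) (simp add: linear_linear)

text \<open>Perturbing \<open>x\<close> by \<open>t *\<^sub>R y\<close> with
  \<open>y = A *v x\<close> makes the form a nonnegative quadratic polynomial in \<open>t\<close>
  without constant term. Its linear coefficient, twice the squared norm of \<open>y\<close>, must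
  then vanish.\<close>

lemma psd_form_zero_imp_kernel:
  fixes A :: "real^'n^'n"
  assumes sym: "\<And>u v. u \<bullet> (A *v v) = v \<bullet> (A *v u)"
    and psd: "\<And>v. 0 \<le> v \<bullet> (A *v v)"
    and x: "x \<bullet> (A *v x) = 0"
  shows "A *v x = 0"
proof -
  define y where "y = A *v x"
  define c where "c = y \<bullet> (A *v y)"
  have "0 \<le> 2 * (y \<bullet> y) * t + c * t\<^sup>2" for t :: real
  proof -
    have "(x + t *\<^sub>R y) \<bullet> (A *v (x + t *\<^sub>R y)) = 2 * (y \<bullet> y) * t + c * t\<^sup>2"
      using x sym[of x y] by (simp add: c_def y_def matrix_vector_right_distrib matrix_vector_mult_scaleR
          inner_add_left inner_add_right power2_eq_square algebra_simps)
    then show ?thesis using psd[of "x + t *\<^sub>R y"] by simp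
  qed
  note * = this
  have "y \<bullet> y = 0"
  proof (cases "c = 0")
    case True
    with *[of "-1"] show ?thesis by (simp add: inner_eq_zero_iff eq_iff)
  next
    case False
    have "c \<ge> 0" using psd by (simp add: c_def)
    with False have "c > 0" by simp
    with *[of "- (y \<bullet> y) / c"] have "(y \<bullet> y)\<^sup>2 \<le> 0"
      by (simp add: power2_eq_square field_simps)
    then show ?thesis by simp
  qed
  then show ?thesis by (simp add: y_def)
qed

text \<open>The eigenvector is a maximiser of the Rayleigh quotient \<open>v \<bullet> B v / v \<bullet> A v\<close>: there the positive
  semidefinite form \<open>l A - B\<close> vanishes.\<close>

lemma pencil_eigenvector:
  fixes A B :: "real^'n^'n"
  assumes symA: "\<And>u v. u \<bullet> (A *v v) = v \<bullet> (A *v u)"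
    and symB: "\<And>u v. u \<bullet> (B *v v) = v \<bullet> (B *v u)"
    and pdA: "\<And>v. v \<noteq> 0 \<Longrightarrow> 0 < v \<bullet> (A *v v)"
  shows "\<exists>x l. x \<noteq> 0 \<and> B *v x = l *\<^sub>R (A *v x) \<and> (\<forall>v. v \<bullet> (B *v v) \<le> l * (v \<bullet> (A *v v)))"
proof -
  let ?q = "\<lambda>v. (v \<bullet> (B *v v)) / (v \<bullet> (A *v v))"
  have "continuous_on (sphere 0 1) ?q"
  proof (intro continuous_on_divide continuous_on_quadratic_form ballI)
    fix v :: "real^'n" assume "v \<in> sphere 0 1"
    then have "v \<noteq> 0" by auto
    then show "v \<bullet> (A *v v) \<noteq> 0" using pdA[of v] by simp
  qed
  moreover have "sphere (0 :: real^'n) 1 \<noteq> {}" by simp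
  ultimately obtain x where x: "x \<in> sphere 0 1" and max: "\<And>v. v \<in> sphere 0 1 \<Longrightarrow> ?q v \<le> ?q x"
    using continuous_attains_sup[OF compact_sphere] by blast
  define l where "l = ?q x"
  have "x \<noteq> 0" using x by auto
  \<comment> \<open>The quotient is invariant under scaling, so its maximum on the sphere is
    global.\<close>
  have le: "v \<bullet> (B *v v) \<le> l * (v \<bullet> (A *v v))" for v
  proof (cases "v = 0")
    case False
    have "?q (v /\<^sub>R norm v) \<le> l" unfolding l_def using False by (intro max) simp
    also have "?q (v /\<^sub>R norm v) = ?q v" using False by (simp add: matrix_vector_mult_scaleR)
    finally show ?thesis using pdA[OF False] by (simp add: field_simps)
  qed simp
  have "(l *\<^sub>R A - B) *v x = 0"
  proof (rule psd_form_zero_imp_kernel)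
    fix u v :: "real^'n"
    have e: "(l *\<^sub>R A - B) *v v = l *\<^sub>R (A *v v) - B *v v" for v
      by (simp add: matrix_vector_mult_diff_rdistrib scaleR_matrix_vector_assoc)
    show "u \<bullet> ((l *\<^sub>R A - B) *v v) = v \<bullet> ((l *\<^sub>R A - B) *v u)"
      by (simp add: e inner_diff_right symA[of u] symB[of u])
    show "0 \<le> v \<bullet> ((l *\<^sub>R A - B) *v v)"
      using le by (simp add: e inner_diff_right)
    show "x \<bullet> ((l *\<^sub>R A - B) *v x) = 0"
      using pdA[OF \<open>x \<noteq> 0\<close>] by (simp only: e inner_diff_right) (simp add: l_def)
  qed
  then have "B *v x = l *\<^sub>R (A *v x)"
    by (simp add: matrix_vector_mult_diff_rdistrib scaleR_matrix_vector_assoc)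
  with le \<open>x \<noteq> 0\<close> show ?thesis by blast
qed

text \<open>The maximal Rayleigh quotient \<open>l\<close> is an eigenvalue of
  \<open>matrix_inv A ** B\<close>, so it cannot exceed the spectral norm, even though this product
  need not be symmetric.\<close>

lemma spectral_norm_bound_imp_quadratic_form_le:
  fixes A B :: "real^'n^'n"
  assumes symA: "\<And>u v. u \<bullet> (A *v v) = v \<bullet> (A *v u)"
    and symB: "\<And>u v. u \<bullet> (B *v v) = v \<bullet> (B *v u)"
    and pdA: "\<And>v. v \<noteq> 0 \<Longrightarrow> 0 < v \<bullet> (A *v v)"
    and inv: "invertible A" and c: "spectral_norm (matrix_inv A ** B) \<le> c"
  shows "v \<bullet> (B *v v) \<le> c * (v \<bullet> (A *v v))"
proof -
  obtain x l where x: "x \<noteq> 0" "B *v x = l *\<^sub>R (A *v x)"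
    and le: "\<And>v. v \<bullet> (B *v v) \<le> l * (v \<bullet> (A *v v))"
    using pencil_eigenvector[OF symA symB pdA] by blast
  have "(matrix_inv A ** B) *v x = l *\<^sub>R ((matrix_inv A ** A) *v x)"
    using x(2) by (simp add: matrix_vector_mul_assoc[symmetric] matrix_vector_mult_scaleR)
  also have "\<dots> = l *\<^sub>R x" using matrix_inv_mult[OF inv] by simp
  finally have "\<bar>l\<bar> * norm x = norm ((matrix_inv A ** B) *v x)" by simp
  also have "\<dots> \<le> spectral_norm (matrix_inv A ** B) * norm x"
    unfolding spectral_norm_def by (rule onorm) (simp add: linear_linear)
  also have "\<dots> \<le> c * norm x" using c by (intro mult_right_mono) auto
  finally have "l \<le> c" using x(1) by simp
  moreover have "0 \<le> v \<bullet> (A *v v)" using pdA[of v] by (cases "v = 0") auto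
  ultimately show ?thesis using le[of v] mult_right_mono by fastforce
qed

text \<open>The pencil of \<open>- A\<close> and the identity yields the largest eigenvalue of
  \<open>- A\<close>, whose negative is the least eigenvalue of \<open>A\<close>. This also shows
  that the \<open>LEAST\<close> in \<open>lambda_min\<close> is attained.\<close>

lemma lambda_min_pd:
  fixes A :: "real^'n^'n"
  assumes sym: "\<And>u v. u \<bullet> (A *v v) = v \<bullet> (A *v u)"
    and pd: "\<And>v. v \<noteq> 0 \<Longrightarrow> 0 < v \<bullet> (A *v v)"
  shows "0 < lambda_min A" "lambda_min A * (v \<bullet> v) \<le> v \<bullet> (A *v v)"
proof -
  have e: "(- A) *v v = - (A *v v)" for v
    using matrix_vector_mult_diff_rdistrib[of 0 A v] by simp
  have "\<exists>x l. x \<noteq> 0 \<and> (- A) *v x = l *\<^sub>R (mat 1 *v x) \<and>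
      (\<forall>v. v \<bullet> ((- A) *v v) \<le> l * (v \<bullet> (mat 1 *v v)))"
  proof (rule pencil_eigenvector[of "mat 1" "- A"])
    show "u \<bullet> (mat 1 *v v) = v \<bullet> (mat 1 *v u)" for u v :: "real^'n"
      by (simp add: inner_commute)
    show "u \<bullet> ((- A) *v v) = v \<bullet> ((- A) *v u)" for u v
      by (simp only: e inner_minus_right sym[of u v])
    show "0 < v \<bullet> (mat 1 *v v)" if "v \<noteq> 0" for v :: "real^'n"
      using that by simp
  qed
  then obtain x l where x: "x \<noteq> 0" "(- A) *v x = l *\<^sub>R (mat 1 *v x)"
    and le: "\<And>v. v \<bullet> ((- A) *v v) \<le> l * (v \<bullet> (mat 1 *v v))"
    by blast
  have le': "- l * (v \<bullet> v) \<le> v \<bullet> (A *v v)" for v using le[of v] by (simp add: e)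
  have "A *v x = (- l) *\<^sub>R x" using x(2) by (simp add: e neg_eq_iff_add_eq_0 add_eq_0_iff2)
  then have ev: "eigenvalue A (- l)" using x(1) unfolding eigenvalue_def by blast
  have "- l \<le> k" if k: "eigenvalue A k" for k
  proof -
    obtain y where y: "y \<noteq> 0" "A *v y = k *\<^sub>R y" using k unfolding eigenvalue_def by blast
    with le'[of y] have "- l * (y \<bullet> y) \<le> k * (y \<bullet> y)" by simp
    with y(1) show ?thesis by (metis inner_gt_zero_iff mult_le_cancel_right_pos)
  qed
  with ev have l: "lambda_min A = - l"
    unfolding lambda_min_def by (intro Least_equality)
  then show "lambda_min A * (v \<bullet> v) \<le> v \<bullet> (A *v v)" using le' by simp
  have "0 < - l * (x \<bullet> x)" using pd[OF x(1)] \<open>A *v x = (- l) *\<^sub>R x\<close> by simp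
  then show "0 < lambda_min A" unfolding l using x(1)
    by (metis inner_gt_zero_iff zero_less_mult_pos2)
qed

subsection \<open>Eigendecompositions and clipping\<close>

lemma orthogonal_matrix_inner:
  fixes V :: "real^'n^'n"
  assumes "orthogonal_matrix V"
  shows "(V *v a) \<bullet> (V *v b) = a \<bullet> b"
proof -
  have "(V *v a) \<bullet> (V *v b) = a \<bullet> (transpose V *v (V *v b))"
    by (metis dot_lmul_matrix inner_commute vector_transpose_matrix transpose_transpose)
  also have "transpose V *v (V *v b) = b"
    using assms by (simp only: orthogonal_matrix matrix_vector_mul_assoc matrix_vector_mul_lid)
  finally show ?thesis .
qed

lemma orthogonal_matrix_norm:
  fixes V :: "real^'n^'n"
  assumes "orthogonal_matrix V"
  shows "norm (V *v a) = norm a"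
  by (simp add: norm_eq_sqrt_inner orthogonal_matrix_inner[OF assms])

lemma diagonal_mult_vec:
  assumes "diagonal S"
  shows "(S *v y) $ i = S $ i $ i * y $ i"
proof -
  have "(S *v y) $ i = (\<Sum>j\<in>UNIV. if j = i then S $ i $ i * y $ i else 0)"
    unfolding matrix_vector_mult_def vec_lambda_beta
    by (rule sum.cong) (use assms in \<open>auto simp: diagonal_def\<close>)
  then show ?thesis by simp
qed

context
  fixes A V S :: "real^'n^'n"
  assumes dec: "eigendecomposition A V S"
begin

lemma eigendecomposition_orthogonal: "orthogonal_matrix V"
  using dec by (simp add: eigendecomposition_def)

lemma eigendecomposition_mult_transpose: "V *v (transpose V *v y) = y"
  using eigendecomposition_orthogonal
  by (simp only: orthogonal_matrix_def matrix_vector_mul_assoc matrix_vector_mul_lid)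

lemma eigendecomposition_mult: "(V *v (A *v y)) $ i = S $ i $ i * (V *v y) $ i"
proof -
  have "V *v (A *v y) = V *v (transpose V *v (S *v (V *v y)))"
    using dec by (simp only: eigendecomposition_def matrix_vector_mul_assoc matrix_mul_assoc)
  also have "\<dots> = S *v (V *v y)" by (rule eigendecomposition_mult_transpose)
  finally show ?thesis using dec by (simp add: eigendecomposition_def diagonal_mult_vec)
qed

lemma eigendecomposition_quadratic_form:
  "y \<bullet> (A *v y) = (\<Sum>i\<in>UNIV. S $ i $ i * ((V *v y) $ i)\<^sup>2)"
proof -
  have "y \<bullet> (A *v y) = (V *v y) \<bullet> (V *v (A *v y))"
    by (simp add: orthogonal_matrix_inner[OF eigendecomposition_orthogonal])
  then show ?thesis
    by (simp add: inner_vec_def eigendecomposition_mult power2_eq_square mult_ac)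
qed

text \<open>The witness is row \<open>i\<close> of \<open>V\<close>. It ties each diagonal entry of
  \<open>S\<close> to a value of the quadratic form.\<close>

lemma eigendecomposition_eigenvector:
  obtains v where "norm v = 1" "v \<bullet> (A *v v) = S $ i $ i"
proof
  let ?v = "transpose V *v axis i 1"
  have "orthogonal_matrix (transpose V)" using eigendecomposition_orthogonal by simp
  from orthogonal_matrix_norm[OF this, of "axis i 1"] show "norm ?v = 1" by simp
  have "?v \<bullet> (A *v ?v) = (\<Sum>j\<in>UNIV. if j = i then S $ i $ i else 0)"
    unfolding eigendecomposition_quadratic_form eigendecomposition_mult_transpose
    by (intro sum.cong) (auto simp: axis_def)
  then show "?v \<bullet> (A *v ?v) = S $ i $ i" by simp
qed

end

lemma clip_nth: "clip z \<rho> $ i = max (min (z $ i) \<rho>) (- \<rho>)"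
  by (simp add: clip_def)

lemma norm_clip_le:
  fixes z :: "real^'n"
  assumes "\<rho> \<ge> 0"
  shows "norm (clip z \<rho>) \<le> sqrt (real CARD('n)) * \<rho>"
proof -
  have "(clip z \<rho> $ i)\<^sup>2 \<le> \<rho>\<^sup>2" for i
    using assms by (intro abs_le_square_iff[THEN iffD1]) (auto simp: clip_nth)
  then have "(\<Sum>i\<in>UNIV. (clip z \<rho> $ i)\<^sup>2) \<le> real CARD('n) * \<rho>\<^sup>2"
    using sum_bounded_above[of UNIV "\<lambda>i. (clip z \<rho> $ i)\<^sup>2" "\<rho>\<^sup>2"] by simp
  then have "(norm (clip z \<rho>))\<^sup>2 \<le> real CARD('n) * \<rho>\<^sup>2"
    by (simp only: power2_norm_eq_inner inner_vec_def) (simp add: power2_eq_square)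
  then have "sqrt ((norm (clip z \<rho>))\<^sup>2) \<le> sqrt (real CARD('n) * \<rho>\<^sup>2)"
    by (rule real_sqrt_le_mono)
  then show ?thesis using assms by (simp add: real_sqrt_mult)
qed

text \<open>Clipping keeps the sign and does not increase the modulus.\<close>

lemma clip_square_le: "\<rho> \<ge> 0 \<Longrightarrow> (clip z \<rho> $ i)\<^sup>2 \<le> z $ i * clip z \<rho> $ i"
  unfolding clip_nth power2_eq_square
  by (smt (verit) mult_right_mono mult_right_mono_neg)

text \<open>The AM-GM weight is chosen so that the \<open>y\<close> terms sum to at most r/4 times
  the Hessian form at \<open>w\<close>, which is at most half of \<open>G\<close> and can be
  absorbed. For a clipped coordinate \<open>p * s\<close> equals
  \<open>\<bar>p\<bar> * \<rho>\<close>.\<close>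

lemma unclipped_or_clipped_bound:
  fixes p y D \<rho> \<sigma> r :: real
  assumes "\<bar>y\<bar> \<le> D" "\<rho> > 0" "\<sigma> > 0" "r > 0"
  defines "s \<equiv> max (min p \<rho>) (- \<rho>)"
  shows "\<bar>p\<bar> \<le> \<rho> \<Longrightarrow> \<sigma> * p * y \<le> \<sigma> * p * s / r + r / 4 * (\<sigma> * y\<^sup>2)"
    and "\<bar>p\<bar> > \<rho> \<Longrightarrow> \<sigma> * p * y \<le> \<sigma> * p * s * D / \<rho>"
proof -
  show "\<sigma> * p * y \<le> \<sigma> * p * s / r + r / 4 * (\<sigma> * y\<^sup>2)" if "\<bar>p\<bar> \<le> \<rho>"
  proof -
    have "s = p" using that by (auto simp: s_def)
    have "0 \<le> \<sigma> / r * (p - r / 2 * y)\<^sup>2" using assms by simp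
    also have "\<dots> = \<sigma> * p * p / r + r / 4 * (\<sigma> * y\<^sup>2) - \<sigma> * p * y"
      using \<open>r > 0\<close> by (simp add: power2_eq_square field_simps)
    finally show ?thesis using \<open>s = p\<close> by simp
  qed
  show "\<sigma> * p * y \<le> \<sigma> * p * s * D / \<rho>" if "\<bar>p\<bar> > \<rho>"
  proof -
    have "p * s = \<bar>p\<bar> * \<rho>" using that assms(2) by (auto simp: s_def abs_if min_def max_def)
    then have "\<sigma> * p * s * D / \<rho> = \<sigma> * (\<bar>p\<bar> * D)" using assms(2) by (simp add: mult.assoc)
    moreover have "p * y \<le> \<bar>p\<bar> * D"
      using abs_ge_self[of "p * y"] mult_left_mono[OF assms(1) abs_ge_zero[of p]]
      unfolding abs_mult by (rule order_trans)
    ultimately show ?thesis using assms(3) by (simp add: mult.assoc)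
  qed
qed

subsection \<open>One step of the method\<close>

locale stable_hessian =
  fixes L :: "real^'n \<Rightarrow> real" and R :: real
  assumes twice_diff: "twice_continuously_differentiable L"
    and convex: "strictly_convex L"
    and R_pos: "R > 0"
    and invertible: "invertible (hessian L x)"
    and stable: "norm (x - x') \<le> R \<Longrightarrow>
           spectral_norm (matrix_inv (hessian L x') ** hessian L x) \<le> 2"
begin

abbreviation "H \<equiv> hessian L"
abbreviation "g \<equiv> gradient L"

lemma differentiable: "L differentiable (at x)" "g differentiable (at x)"
  using twice_diff by (auto simp: twice_continuously_differentiable_def)

lemma H_sym: "u \<bullet> (H x *v v) = v \<bullet> (H x *v u)"
  using hessian_symmetric differentiable .

lemma H_psd: "0 \<le> v \<bullet> (H x *v v)"
  using hessian_nonneg[OF differentiable convex] .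

text \<open>Convexity gives only semidefiniteness; invertibility excludes a kernel and upgrades
  it.\<close>

lemma H_pd: "v \<noteq> 0 \<Longrightarrow> 0 < v \<bullet> (H x *v v)"
proof (rule ccontr)
  assume "v \<noteq> 0" "\<not> 0 < v \<bullet> (H x *v v)"
  with H_psd[of v x] have "v \<bullet> (H x *v v) = 0" by simp
  then have "H x *v v = 0" by (rule psd_form_zero_imp_kernel[OF H_sym H_psd])
  then have "(matrix_inv (H x) ** H x) *v v = 0"
    by (simp add: matrix_vector_mul_assoc[symmetric])
  with matrix_inv_mult[OF invertible] \<open>v \<noteq> 0\<close> show False by simp
qed

lemma H_stable:
  assumes "norm (x - x') \<le> R"
  shows "v \<bullet> (H x *v v) \<le> 2 * (v \<bullet> (H x' *v v))"
  by (rule spectral_norm_bound_imp_quadratic_form_le[OF H_sym H_sym H_pd invertible stable[OF assms]])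

lemma gradient_slope_along_segment:
  assumes "a < b"
  obtains t where "a < t" "t < b"
    "g (x + b *\<^sub>R w) \<bullet> w - g (x + a *\<^sub>R w) \<bullet> w = (b - a) * (w \<bullet> (H (x + t *\<^sub>R w) *v w))"
  using MVT2[OF assms DERIV_gradient_along_line[OF differentiable(2), of x w w]]
  by (auto simp: inner_commute)

lemma gradient_mono_along_segment:
  assumes "a \<le> b"
  shows "g (x + a *\<^sub>R w) \<bullet> w \<le> g (x + b *\<^sub>R w) \<bullet> w"
proof (cases "a = b")
  case False
  with assms have "a < b" by simp
  then obtain t where "g (x + b *\<^sub>R w) \<bullet> w - g (x + a *\<^sub>R w) \<bullet> w = (b - a) * (w \<bullet> (H (x + t *\<^sub>R w) *v w))"
    by (rule gradient_slope_along_segment)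
  moreover have "0 \<le> (b - a) * (w \<bullet> (H (x + t *\<^sub>R w) *v w))"
    using assms H_psd by simp
  ultimately show ?thesis by simp
qed simp

lemma eigenvalue_pos:
  assumes "eigendecomposition (H x) V S"
  shows "0 < S $ i $ i"
proof -
  obtain v where "norm v = 1" "v \<bullet> (H x *v v) = S $ i $ i"
    using eigendecomposition_eigenvector[OF assms] .
  moreover from this have "v \<noteq> 0" by auto
  ultimately show ?thesis using H_pd[of v x] by simp
qed

text \<open>With \<open>H x = V\<^sup>T S V\<close>, the \<open>i\<close>-th coordinate of the gradient in the eigenbasis is
  \<open>S $ i $ i * newton V x $ i\<close>, so \<open>decrement\<close> is the inner product of the gradient with the
  clipped Newton step.\<close>

definition newton :: "real^'n^'n \<Rightarrow> real^'n \<Rightarrow> real^'n" where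
  "newton V x = V *v (matrix_inv (H x) *v g x)"

definition decrement :: "real \<Rightarrow> real^'n^'n \<Rightarrow> real^'n^'n \<Rightarrow> real^'n \<Rightarrow> real" where
  "decrement \<rho> V S x = (\<Sum>i\<in>UNIV. S $ i $ i * newton V x $ i * clip (newton V x) \<rho> $ i)"

lemma gradient_inner_eq:
  assumes "eigendecomposition (H x) V S"
  shows "g x \<bullet> w = (\<Sum>i\<in>UNIV. S $ i $ i * newton V x $ i * (V *v w) $ i)"
proof -
  have "g x = H x *v (matrix_inv (H x) *v g x)"
    using matrix_inv_mult[OF invertible, of x] by (simp add: matrix_vector_mul_assoc)
  then have "(V *v g x) $ i = S $ i $ i * newton V x $ i" for i
    using eigendecomposition_mult[OF assms] by (metis newton_def)
  moreover have "g x \<bullet> w = (V *v g x) \<bullet> (V *v w)"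
    by (simp add: orthogonal_matrix_inner[OF eigendecomposition_orthogonal[OF assms]])
  ultimately show ?thesis by (simp add: inner_vec_def)
qed

text \<open>Moving by \<open>- (1/2) *\<^sub>R s\<close> contributes -W/2 to first order. The step
  stays within \<open>R\<close> of \<open>x\<close>, where the form at \<open>s\<close> is at most
  twice its value at \<open>x\<close>, hence at most 2 W; so the Taylor remainder is at most
  (1/2)(1/4)(2 W) = W/4.\<close>

lemma descent:
  assumes dec: "eigendecomposition (H x) V S" and \<rho>: "\<rho> \<ge> 0" "sqrt (real CARD('n)) * \<rho> \<le> R"
  shows "L (x - (1/2) *\<^sub>R (transpose V *v clip (newton V x) \<rho>)) \<le> L x - decrement \<rho> V S x / 4"
proof -
  define s where "s = transpose V *v clip (newton V x) \<rho>"
  define W where "W = decrement \<rho> V S x"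
  have Vs: "V *v s = clip (newton V x) \<rho>"
    unfolding s_def by (rule eigendecomposition_mult_transpose[OF dec])
  have "norm s = norm (clip (newton V x) \<rho>)"
    using orthogonal_matrix_norm[OF eigendecomposition_orthogonal[OF dec], of s] Vs by simp
  with norm_clip_le[OF \<rho>(1), of "newton V x"] \<rho>(2) have ns: "norm s \<le> R" by simp
  have gs: "g x \<bullet> s = W"
    unfolding gradient_inner_eq[OF dec] Vs W_def decrement_def ..
  have Hs: "s \<bullet> (H x *v s) \<le> W"
    unfolding eigendecomposition_quadratic_form[OF dec] Vs W_def decrement_def
  proof (rule sum_mono)
    fix i
    show "S $ i $ i * (clip (newton V x) \<rho> $ i)\<^sup>2 \<le> S $ i $ i * newton V x $ i * clip (newton V x) \<rho> $ i"
      using mult_left_mono[OF clip_square_le[OF \<rho>(1)] less_imp_le[OF eigenvalue_pos[OF dec]]]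
      by (simp add: mult.assoc)
  qed
  have "(H (x + t *\<^sub>R (- (1/2) *\<^sub>R s)) *v (- (1/2) *\<^sub>R s)) \<bullet> (- (1/2) *\<^sub>R s) \<le> W / 2"
    if "0 \<le> t" "t \<le> 1" for t
  proof -
    have "t * norm s \<le> 1 * norm s" using that by (intro mult_right_mono) auto
    then have "norm ((x + t *\<^sub>R (- (1/2) *\<^sub>R s)) - x) \<le> R" using that ns R_pos by simp
    from H_stable[OF this, of s] Hs
    have "s \<bullet> (H (x + t *\<^sub>R (- (1/2) *\<^sub>R s)) *v s) \<le> 2 * W" by simp
    then show ?thesis
      unfolding matrix_vector_mult_scaleR inner_scaleR_left inner_scaleR_right
      by (simp add: inner_commute)
  qed
  from second_order_Taylor_upper[of L, OF differentiable this] gs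
  have "L (x - (1/2) *\<^sub>R s) \<le> L x - W / 4" by (simp add: inner_commute)
  then show ?thesis unfolding s_def W_def .
qed

lemma decrement_lower_bound:
  assumes dec: "eigendecomposition (H x) V S" and \<rho>: "\<rho> > 0" "2 * \<rho> \<le> R"
    and \<mu>: "\<mu> > 0" "\<And>v. \<mu> * (v \<bullet> v) \<le> v \<bullet> (H m *v v)" and m: "g m = 0"
  shows "min (\<mu> * \<rho>\<^sup>2 / 4) ((L x - L m) / 2) \<le> decrement \<rho> V S x"
proof -
  define p where "p = newton V x"
  define s where "s = clip p \<rho>"
  define W where "W = decrement \<rho> V S x"
  define w where "w = x - m"
  define D where "D = norm w"
  \<comment> \<open>The fraction of the segment between \<open>x\<close> and \<open>m\<close> that
    fits into length \<open>R\<close>; thus \<open>r * D\<close> is the minimum of \<open>D\<close>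
    and \<open>R\<close>.\<close>
  define r where "r = (if D \<le> R then 1 else R / D)"
  define y where "y = V *v w"
  define G where "G = g x \<bullet> w"
  define C where "C = {i. \<bar>p $ i\<bar> > \<rho>}"
  have \<sigma>: "S $ i $ i > 0" for i by (rule eigenvalue_pos[OF dec])
  have W: "W = (\<Sum>i\<in>UNIV. S $ i $ i * p $ i * s $ i)"
    by (simp add: W_def decrement_def p_def s_def)
  have W_term: "S $ i $ i * p $ i * s $ i \<ge> 0" for i
  proof -
    have "0 \<le> p $ i * s $ i" using order_trans[OF zero_le_power2 clip_square_le[of \<rho> p i]] \<rho>(1) by (simp add: s_def)
    then show ?thesis using \<sigma>[of i] by (simp add: mult.assoc)
  qed
  have W_nonneg: "W \<ge> 0" unfolding W by (intro sum_nonneg W_term)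
  show ?thesis
  proof (cases "x = m")
    case True
    then show ?thesis using W_nonneg by (simp add: W_def min.coboundedI2)
  next
    case False
    have "D > 0" using False by (simp add: D_def w_def)
    have r: "0 < r" "r \<le> 1" "r * D \<le> R" using \<open>D > 0\<close> R_pos by (auto simp: r_def)
    have xm: "m + 1 *\<^sub>R w = x" "m + 0 *\<^sub>R w = m" by (simp_all add: w_def)
    have LG: "L x - L m \<le> G"
      using strictly_convex_above_tangent[OF differentiable(1) convex, of x "- w"]
      by (simp add: G_def w_def inner_diff_right)
    \<comment> \<open>Moving from \<open>x\<close> towards \<open>m\<close> by \<open>r * D \<le> R\<close> keeps half of the curvature at \<open>x\<close>, while the
      directional derivative decreases but stays nonnegative.\<close>
    have HG: "r / 2 * (w \<bullet> (H x *v w)) \<le> G"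
    proof -
      obtain t where t: "1 - r < t" "t < 1" and eq:
        "g (m + 1 *\<^sub>R w) \<bullet> w - g (m + (1 - r) *\<^sub>R w) \<bullet> w = (1 - (1 - r)) * (w \<bullet> (H (m + t *\<^sub>R w) *v w))"
        using gradient_slope_along_segment[of "1 - r" 1 m w] r by auto
      have "g (m + 0 *\<^sub>R w) \<bullet> w \<le> g (m + (1 - r) *\<^sub>R w) \<bullet> w"
        using r by (intro gradient_mono_along_segment) simp
      with eq m have 1: "r * (w \<bullet> (H (m + t *\<^sub>R w) *v w)) \<le> G"
        unfolding xm G_def by simp
      have "x - (m + t *\<^sub>R w) = (1 - t) *\<^sub>R w" by (simp add: w_def algebra_simps)
      moreover have "(1 - t) * D \<le> r * D" using t \<open>D > 0\<close> by (intro mult_right_mono) auto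
      ultimately have "norm (x - (m + t *\<^sub>R w)) \<le> R" using t r by (simp add: D_def)
      from H_stable[OF this, of w] r
      have "r / 2 * (w \<bullet> (H x *v w)) \<le> r / 2 * (2 * (w \<bullet> (H (m + t *\<^sub>R w) *v w)))"
        by (intro mult_left_mono) auto
      with 1 show ?thesis by simp
    qed
    have yD: "\<bar>y $ i\<bar> \<le> D" for i
      using component_le_norm_cart[of y i]
      by (simp add: y_def D_def orthogonal_matrix_norm[OF eigendecomposition_orthogonal[OF dec]])
    have G: "G = (\<Sum>i\<in>UNIV. S $ i $ i * p $ i * y $ i)"
      unfolding G_def gradient_inner_eq[OF dec] by (simp add: p_def y_def)
    \<comment> \<open>By \<open>HG\<close> the AM-GM terms sum to at most G/2. Moving this to the
      left doubles the remaining terms.\<close>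
    have Gsplit: "G \<le> 2 * W / r + (if C = {} then 0 else 2 * W * D / \<rho>)"
    proof -
      \<comment> \<open>All added terms are nonnegative, so one formula covers clipped and unclipped
        coordinates.\<close>
      have bound: "S $ i $ i * p $ i * y $ i \<le> S $ i $ i * p $ i * s $ i / r + r / 4 * (S $ i $ i * (y $ i)\<^sup>2)
          + (if C = {} then 0 else S $ i $ i * p $ i * s $ i * D / \<rho>)" for i
      proof (cases "i \<in> C")
        case True
        have "S $ i $ i * p $ i * y $ i \<le> S $ i $ i * p $ i * s $ i * D / \<rho>"
          using unclipped_or_clipped_bound(2)[OF yD \<rho>(1) \<sigma> r(1), of "p $ i" i] True
          by (simp add: C_def s_def clip_nth)
        moreover have "0 \<le> S $ i $ i * p $ i * s $ i / r" using W_term r by simp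
        moreover have "0 \<le> r / 4 * (S $ i $ i * (y $ i)\<^sup>2)" using \<sigma>[of i] r by simp
        ultimately show ?thesis using True by auto
      next
        case False
        have "S $ i $ i * p $ i * y $ i \<le> S $ i $ i * p $ i * s $ i / r + r / 4 * (S $ i $ i * (y $ i)\<^sup>2)"
          using unclipped_or_clipped_bound(1)[OF yD \<rho>(1) \<sigma> r(1), of "p $ i" i] False
          by (simp add: C_def s_def clip_nth)
        moreover have "0 \<le> S $ i $ i * p $ i * s $ i * D / \<rho>" using W_term[of i] \<rho> \<open>D > 0\<close> by simp
        ultimately show ?thesis by auto
      qed
      have "G \<le> (\<Sum>i\<in>UNIV. S $ i $ i * p $ i * s $ i / r + r / 4 * (S $ i $ i * (y $ i)\<^sup>2)
          + (if C = {} then 0 else S $ i $ i * p $ i * s $ i * D / \<rho>))"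
        unfolding G by (rule sum_mono[OF bound])
      also have "\<dots> = W / r + r / 4 * (w \<bullet> (H x *v w)) + (if C = {} then 0 else W * D / \<rho>)"
        unfolding W eigendecomposition_quadratic_form[OF dec] y_def
        by (simp add: sum.distrib sum_divide_distrib sum_distrib_left sum_distrib_right)
      finally show ?thesis using HG by (auto split: if_splits)
    qed
    show ?thesis
    proof (cases "D \<le> R")
      case True
      then have "r = 1" by (simp add: r_def)
      show ?thesis
      proof (cases "C = {}")
        case True
        then show ?thesis using Gsplit LG \<open>r = 1\<close> by (simp add: W_def min.coboundedI2)
      next
        case False
        then obtain i where i: "\<bar>p $ i\<bar> > \<rho>" by (auto simp: C_def)
        obtain v where v: "norm v = 1" "v \<bullet> (H x *v v) = S $ i $ i"
          using eigendecomposition_eigenvector[OF dec] .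
        have "norm (m - x) \<le> R" using True by (simp add: D_def w_def norm_minus_commute)
        from H_stable[OF this, of v] \<mu>(2)[of v] v have \<sigma>\<mu>: "\<mu> / 2 \<le> S $ i $ i"
          by (simp add: dot_square_norm)
        have "\<rho>\<^sup>2 = (s $ i)\<^sup>2" using i \<rho>(1) by (auto simp: s_def clip_nth power2_eq_square)
        also have "\<dots> \<le> p $ i * s $ i" unfolding s_def using \<rho>(1) by (intro clip_square_le) simp
        finally have "\<mu> / 2 * \<rho>\<^sup>2 \<le> S $ i $ i * (p $ i * s $ i)"
          using \<sigma>\<mu> \<mu>(1) \<sigma>[of i] by (intro mult_mono) auto
        also have "\<dots> \<le> W"
          unfolding W mult.assoc[symmetric] by (rule member_le_sum) (auto intro: W_term)
        \<comment> \<open>In fact \<open>W\<close> is at least twice this; the constant 1/4 is the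
          one reached when \<open>D > R\<close>.\<close>
        finally have "\<mu> * \<rho>\<^sup>2 / 4 \<le> W" using W_nonneg by simp
        then show ?thesis by (simp add: W_def min.coboundedI1)
      qed
    next
      case False
      then have "r = R / D" "r < 1" using \<open>D > 0\<close> by (auto simp: r_def)
      \<comment> \<open>The initial stretch of length \<open>R\<close> from \<open>m\<close> has
        curvature at least \<open>\<mu> * D\<^sup>2 / 2\<close> along \<open>w\<close>; beyond it
        the slope does not decrease.\<close>
      have "\<mu> * R * D / 2 \<le> G"
      proof -
        obtain t where t: "0 < t" "t < r" and eq:
          "g (m + r *\<^sub>R w) \<bullet> w - g (m + 0 *\<^sub>R w) \<bullet> w = (r - 0) * (w \<bullet> (H (m + t *\<^sub>R w) *v w))"
          using gradient_slope_along_segment[of 0 r m w] r by auto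
        have "g (m + r *\<^sub>R w) \<bullet> w \<le> g (m + 1 *\<^sub>R w) \<bullet> w"
          using r by (intro gradient_mono_along_segment) simp
        with eq m have 1: "r * (w \<bullet> (H (m + t *\<^sub>R w) *v w)) \<le> G"
          unfolding xm G_def by simp
        have "t * D \<le> r * D" using t \<open>D > 0\<close> by (intro mult_right_mono) auto
        then have "norm (m - (m + t *\<^sub>R w)) \<le> R" using t r by (simp add: D_def)
        from H_stable[OF this, of w] \<mu>(2)[of w] have "\<mu> * D\<^sup>2 / 2 \<le> w \<bullet> (H (m + t *\<^sub>R w) *v w)"
          by (simp add: D_def dot_square_norm)
        then have "r * (\<mu> * D\<^sup>2 / 2) \<le> r * (w \<bullet> (H (m + t *\<^sub>R w) *v w))"
          using r by (intro mult_left_mono) auto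
        with 1 have "r * (\<mu> * D\<^sup>2 / 2) \<le> G" by (rule order_trans[rotated])
        then show ?thesis using \<open>D > 0\<close> by (simp add: \<open>r = R / D\<close> power2_eq_square mult_ac)
      qed
      also have "G \<le> 2 * W * D / R + 2 * W * D / \<rho>"
      proof -
        have "0 \<le> 2 * W * D / \<rho>" using W_nonneg \<open>D > 0\<close> \<rho> by simp
        then show ?thesis using Gsplit by (auto simp: \<open>r = R / D\<close> split: if_splits)
      qed
      also have "2 * W * D / R \<le> 2 * W * D / \<rho>"
        using W_nonneg \<open>D > 0\<close> \<rho> R_pos by (intro divide_left_mono) auto
      finally have "\<mu> * R * D / 2 \<le> 4 * W * D / \<rho>" by (simp add: mult.commute)
      \<comment> \<open>Both sides are linear in \<open>D\<close>, so the distance to the minimizer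
        cancels.\<close>
      then have "\<mu> * R * \<rho> \<le> 8 * W" using \<open>D > 0\<close> \<rho>(1) by (simp add: field_simps)
      moreover have "\<mu> * \<rho> * (2 * \<rho>) \<le> \<mu> * \<rho> * R" using \<mu> \<rho> by (intro mult_left_mono) auto
      ultimately have "\<mu> * \<rho>\<^sup>2 / 4 \<le> W" by (simp add: power2_eq_square mult_ac)
      then show ?thesis by (simp add: W_def min.coboundedI1)
    qed
  qed
qed

end

subsection \<open>Convergence\<close>

text \<open>The two arguments of \<open>min\<close> agree at \<open>\<delta> t = a / 2\<close>.
  Above this threshold the decrease is at least \<open>a / 16\<close> per step; below it the excess
  shrinks by the factor 7/8.\<close>

lemma two_phase_rate:
  fixes \<delta> :: "nat \<Rightarrow> real"
  assumes nonneg: "\<And>t. \<delta> t \<ge> 0" and "a > 0" "\<epsilon> > 0"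
    and step: "\<And>t. \<delta> (Suc t) \<le> \<delta> t - min (a / 16) (\<delta> t / 8)"
  shows "\<exists>T. \<delta> T \<le> \<epsilon> \<and> real T \<le> 1000 * (\<delta> 0 / (4 * a) + max 0 (ln (a / (8 * \<epsilon>))))"
proof (cases "\<delta> 0 \<le> \<epsilon>")
  case True
  then show ?thesis using nonneg[of 0] \<open>a > 0\<close> by (intro exI[of _ 0]) simp
next
  case False
  have linear_phase: "(\<exists>s\<le>t. \<delta> s \<le> a / 2) \<or> \<delta> t \<le> \<delta> 0 - real t * (a / 16)" for t
  proof (induction t)
    case (Suc t)
    then consider "\<exists>s\<le>t. \<delta> s \<le> a / 2" | "\<delta> t > a / 2" "\<delta> t \<le> \<delta> 0 - real t * (a / 16)"
      by force
    then show ?case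
    proof cases
      case 2
      then have "\<delta> (Suc t) \<le> \<delta> t - a / 16" using step[of t] by simp
      moreover have "real (Suc t) * (a / 16) = real t * (a / 16) + a / 16" by (simp add: field_simps)
      ultimately have "\<delta> (Suc t) \<le> \<delta> 0 - real (Suc t) * (a / 16)" using 2 by linarith
      then show ?thesis ..
    qed (auto intro: le_SucI)
  qed simp
  obtain T1 where T1: "\<delta> T1 \<le> a / 2" "real T1 \<le> 18 * (\<delta> 0 / a)"
  proof (cases "\<delta> 0 \<le> a / 2")
    case True
    then show thesis using that[of 0] nonneg[of 0] \<open>a > 0\<close> by simp
  next
    case False
    \<comment> \<open>By step \<open>n\<close> the linear decrease would make the excess negative,
      so the threshold has been crossed. As \<open>\<delta> 0 / a\<close> exceeds 1/2, the rounding
      error 1 is at most twice it, whence 18 = 16 + 2.\<close>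
    define n where "n = nat \<lfloor>16 * (\<delta> 0 / a)\<rfloor> + 1"
    have q: "\<delta> 0 / a > 1 / 2" using False \<open>a > 0\<close> by (simp add: field_simps)
    have n: "real n > 16 * (\<delta> 0 / a)" "real n \<le> 16 * (\<delta> 0 / a) + 1"
      unfolding n_def using q by linarith+
    from n(1) have "\<delta> 0 - real n * (a / 16) < 0" using \<open>a > 0\<close> by (simp add: field_simps)
    with linear_phase[of n] nonneg[of n] obtain s where s: "s \<le> n" "\<delta> s \<le> a / 2" by force
    from s(1) have "real s \<le> real n" by simp
    with that[OF s(2)] n(2) q show thesis by linarith
  qed
  \<comment> \<open>Going from \<open>a / 2\<close> down to \<open>\<epsilon>\<close> costs the
    logarithm of \<open>a / (2 * \<epsilon>)\<close>; the one in the bound is smaller by ln 4, which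
    is at most 3.\<close>
  have "a / (2 * \<epsilon>) = 4 * (a / (8 * \<epsilon>))" by simp
  then have "ln (a / (2 * \<epsilon>)) = ln 4 + ln (a / (8 * \<epsilon>))"
    using \<open>a > 0\<close> \<open>\<epsilon> > 0\<close> by (metis ln_mult_pos divide_pos_pos mult_pos_pos zero_less_numeral)
  then have ln_le: "ln (a / (2 * \<epsilon>)) \<le> 3 + ln (a / (8 * \<epsilon>))" using ln_le_minus_one[of 4] by simp
  have geometric_phase: "\<delta> (T1 + k) \<le> (7 / 8) ^ k * (a / 2)" for k
  proof (induction k)
    case (Suc k)
    \<comment> \<open>The excess remains below \<open>a / 2\<close>, so \<open>min\<close> stays on
      the geometric branch.\<close>
    have "(7 / 8 :: real) ^ k \<le> 1" by (rule power_le_one) auto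
    then have "(7 / 8) ^ k * (a / 2) \<le> 1 * (a / 2)" using \<open>a > 0\<close> by (intro mult_right_mono) auto
    with Suc have "\<delta> (T1 + k) / 8 \<le> a / 16" by simp
    with step[of "T1 + k"] have "\<delta> (T1 + Suc k) \<le> 7 / 8 * \<delta> (T1 + k)" by simp
    with Suc show ?case by simp
  qed (use T1 in simp)
  define X where "X = max 0 (ln (a / (8 * \<epsilon>)))"
  have "X \<ge> 0" by (simp add: X_def)
  \<comment> \<open>Since 7/8 is at most exp(-1/8), it suffices that \<open>k\<close> is at least
    eight times the logarithm just bounded.\<close>
  obtain k :: nat where k: "real k \<ge> 8 * (X + 3)" "real k \<le> 8 * (X + 3) + 1"
  proof -
    define Y where "Y = 8 * (X + 3)"
    have "Y \<ge> 0" using \<open>X \<ge> 0\<close> by (simp add: Y_def)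
    then have "real (nat \<lceil>Y\<rceil>) \<ge> Y" "real (nat \<lceil>Y\<rceil>) \<le> Y + 1" by linarith+
    then show thesis unfolding Y_def by (rule that)
  qed
  have "(7 / 8 :: real) ^ k \<le> exp (- 1 / 8) ^ k"
    using exp_ge_add_one_self[of "- 1 / 8 :: real"] by (intro power_mono) auto
  also have "\<dots> = exp (- real k / 8)" by (simp add: exp_of_nat_mult[symmetric])
  also have "\<dots> \<le> exp (- ln (a / (2 * \<epsilon>)))" using k(1) ln_le by (simp add: X_def)
  also have "\<dots> = 2 * \<epsilon> / a" using \<open>a > 0\<close> \<open>\<epsilon> > 0\<close> by (simp add: exp_minus)
  finally have "(7 / 8) ^ k * (a / 2) \<le> 2 * \<epsilon> / a * (a / 2)"
    using \<open>a > 0\<close> by (intro mult_right_mono) auto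
  with geometric_phase[of k] \<open>a > 0\<close> have "\<delta> (T1 + k) \<le> \<epsilon>" by simp
  moreover have "real (T1 + k) \<le> 1000 * (\<delta> 0 / (4 * a) + X)"
  \<comment> \<open>The additive constant 25 from the choice of \<open>k\<close> has to be absorbed.
    As \<open>\<delta> 0 > \<epsilon>\<close> in this case, the facts below give
    \<open>X + 8 * q \<ge> 1\<close>, so \<open>X\<close> and \<open>q\<close> are not both
    small.\<close>
  proof -
    define q where "q = \<delta> 0 / a"
    have "\<epsilon> / a \<le> q" unfolding q_def using False \<open>a > 0\<close> by (intro divide_right_mono) auto
    moreover have "1 - 8 * (\<epsilon> / a) \<le> X"
      using ln_le_minus_one[of "8 * \<epsilon> / a"] ln_div[of a "8 * \<epsilon>"] ln_div[of "8 * \<epsilon>" a] \<open>a > 0\<close> \<open>\<epsilon> > 0\<close>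
      by (simp add: X_def)
    moreover have "\<delta> 0 / (4 * a) = q / 4" by (simp add: q_def)
    ultimately show ?thesis using T1(2) k(2) \<open>X \<ge> 0\<close> unfolding q_def[symmetric] of_nat_add by argo
  qed
  ultimately show ?thesis unfolding X_def by blast
qed

text \<open>The universal constant is made explicit as 1000. The logarithm is truncated at 0 because
  it is negative for large \<open>\<epsilon>\<close>, while \<open>T\<close> is a natural number.
  \<open>V\<close> and \<open>S\<close> are arbitrary sequences, so every choice of
  eigendecompositions is covered.\<close>

theorem theorem4p3:
  fixes L :: "real^'n \<Rightarrow> real"
    and \<theta>\<^sub>m\<^sub>i\<^sub>n \<theta>\<^sub>0 :: "real^'n"
    and \<theta> :: "nat \<Rightarrow> real^'n"
    and V S :: "nat \<Rightarrow> real^'n^'n"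
    and R \<mu> \<eta> \<rho> \<epsilon> :: real
  assumes "twice_continuously_differentiable L"
    and "strictly_convex L"
    and "\<forall>x. L \<theta>\<^sub>m\<^sub>i\<^sub>n \<le> L x"
    and "\<mu> = lambda_min (hessian L \<theta>\<^sub>m\<^sub>i\<^sub>n)"
    and "R > 0"
    and "\<forall>x. invertible (hessian L x)"
    and "\<forall>x x'. norm (x - x') \<le> R \<longrightarrow>
           spectral_norm (matrix_inv (hessian L x') ** hessian L x) \<le> 2"
    and "\<eta> = 1 / 2"
    and "\<rho> = R / (2 * sqrt (real CARD('n)))"
    and "\<theta> 0 = \<theta>\<^sub>0"
    and "\<forall>t. eigendecomposition (hessian L (\<theta> t)) (V t) (S t)"
    and "\<forall>t. \<theta> (Suc t) = \<theta> t - \<eta> *\<^sub>R (transpose (V t) *v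
           clip (V t *v (matrix_inv (hessian L (\<theta> t)) *v gradient L (\<theta> t))) \<rho>)"
    and "\<epsilon> > 0"
  shows "\<exists>T. L (\<theta> T) - L \<theta>\<^sub>m\<^sub>i\<^sub>n \<le> \<epsilon> \<and>
           real T \<le> 1000 * (real CARD('n) * ((L \<theta>\<^sub>0 - L \<theta>\<^sub>m\<^sub>i\<^sub>n) / (\<mu> * R\<^sup>2))
                            + max 0 (ln (\<mu> * R\<^sup>2 / (32 * real CARD('n) * \<epsilon>))))"
proof -
  interpret stable_hessian L R
    using assms(1,2,5-7) by unfold_locales auto
  let ?d = "real CARD('n)"
  let ?m = "\<theta>\<^sub>m\<^sub>i\<^sub>n"
  have d: "?d \<ge> 1" by (simp add: Suc_le_eq)
  then have "sqrt ?d \<ge> 1" by simp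
  have \<rho>: "\<rho> > 0" using R_pos d unfolding assms(9) by (intro divide_pos_pos) auto
  have R_eq: "R = 2 * (sqrt ?d * \<rho>)" using d by (simp add: assms(9))
  \<comment> \<open>The first bound is what \<open>decrement_lower_bound\<close> asks for, the
    second what \<open>descent\<close> asks for.\<close>
  have \<rho>_le: "2 * \<rho> \<le> R" "sqrt ?d * \<rho> \<le> R"
    using R_eq \<rho> mult_right_mono[OF \<open>sqrt ?d \<ge> 1\<close> less_imp_le[OF \<rho>]] by auto
  have R2: "R\<^sup>2 = 4 * ?d * \<rho>\<^sup>2"
    using d by (simp add: assms(9) power_divide power_mult_distrib)
  have \<mu>: "\<mu> > 0" "\<mu> * (v \<bullet> v) \<le> v \<bullet> (H ?m *v v)" for v
    unfolding assms(4) by (rule lambda_min_pd[OF H_sym H_pd], assumption)+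
  \<comment> \<open>The derivative at the minimizer in the direction of the gradient is the squared
    norm of the gradient.\<close>
  have "g ?m \<bullet> g ?m = 0"
    by (rule DERIV_local_min[OF DERIV_along_line[OF differentiable(1), of ?m "g ?m" 0, simplified] zero_less_one])
      (use assms(3) in simp)
  then have m: "g ?m = 0" by simp
  define \<delta> where "\<delta> t = L (\<theta> t) - L ?m" for t
  have "\<delta> (Suc t) \<le> \<delta> t - min (\<mu> * \<rho>\<^sup>2 / 16) (\<delta> t / 8)" for t
  proof -
    have dec: "eigendecomposition (H (\<theta> t)) (V t) (S t)" using assms(11) by blast
    have "\<theta> (Suc t) = \<theta> t - (1/2) *\<^sub>R (transpose (V t) *v clip (newton (V t) (\<theta> t)) \<rho>)"
      using assms(8,12) by (simp add: newton_def)
    then have "\<delta> (Suc t) \<le> \<delta> t - decrement \<rho> (V t) (S t) (\<theta> t) / 4"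
      using descent[OF dec less_imp_le[OF \<rho>] \<rho>_le(2)] by (simp add: \<delta>_def)
    moreover have "min (\<mu> * \<rho>\<^sup>2 / 4) (\<delta> t / 2) \<le> decrement \<rho> (V t) (S t) (\<theta> t)"
      unfolding \<delta>_def by (rule decrement_lower_bound[OF dec \<rho> \<rho>_le(1) \<mu> m])
    ultimately show ?thesis by linarith
  qed
  moreover have "\<delta> t \<ge> 0" for t using assms(3) by (simp add: \<delta>_def)
  ultimately obtain T where T: "\<delta> T \<le> \<epsilon>"
    "real T \<le> 1000 * (\<delta> 0 / (4 * (\<mu> * \<rho>\<^sup>2)) + max 0 (ln (\<mu> * \<rho>\<^sup>2 / (8 * \<epsilon>))))"
    using two_phase_rate[of \<delta> "\<mu> * \<rho>\<^sup>2" \<epsilon>] \<mu>(1) \<rho> assms(13) by auto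
  have "\<delta> 0 / (4 * (\<mu> * \<rho>\<^sup>2)) = ?d * ((L \<theta>\<^sub>0 - L ?m) / (\<mu> * R\<^sup>2))"
    using d by (simp add: R2 \<delta>_def assms(10))
  moreover have "\<mu> * \<rho>\<^sup>2 / (8 * \<epsilon>) = \<mu> * R\<^sup>2 / (32 * ?d * \<epsilon>)"
    using d assms(13) by (simp add: R2)
  ultimately show ?thesis using T by (auto simp: \<delta>_def)
qed

end
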